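(* Let $\delta>0$, let $\eta_0,\eta_1\in\mathbb{R}$, and let $\overline{y}$ be the pure vertical mode at energy $E(\eta_0,\eta_1)$, that is, the unique (periodic) solution of $$\ddot{y}+3y+\tfrac32 y^3=0,\qquad y(0)=\eta_0,\quad \dot{y}(0)=\eta_1 .$$ Then $\overline{y}$ is torsionally stable for the isolated system $$\begin{cases}\ddot{y}_1+3y_1+\frac32 y_1^3+\frac92 y_1z_1^2=0\\ \ddot{z}_1+7z_1+\frac92 z_1^3+\frac{27}{2}z_1y_1^2=0\end{cases}$$ if and only if it is torsionally stable for the system with aerodynamic forces $$\begin{cases}\ddot{y}_1+3y_1+\frac32 y_1^3+\frac92 y_1z_1^2+\delta\dot{z}_1=0\\ \ddot{z}_1+7z_1+\frac92 z_1^3+\frac{27}{2}z_1y_1^2+\delta\dot{y}_1=0,\end{cases}$$ where torsional stability for each of the two systems is as defined in the context.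
   Context: All functions are real-valued functions of time $t$, and dots denote derivatives with respect to $t$. The energy of the vertical mode $\overline{y}$ (the solution of $\ddot{y}+3y+\frac32 y^3=0$ with $y(0)=\eta_0$, $\dot y(0)=\eta_1$) is the conserved quantity $$E(\eta_0,\eta_1)=\frac{\dot{\overline{y}}^2}{2}+\frac32\overline{y}^2+\frac38\overline{y}^4\equiv\frac{\eta_1^2}{2}+\frac32\eta_0^2+\frac38\eta_0^4 .$$ Set $a(t)=7+\frac{27}{2}\overline{y}(t)^2$. Torsional stability for the isolated system (the one without $\delta$-terms): the vertical mode $\overline{y}$ at energy $E(\eta_0,\eta_1)$ is called torsionally stable for this system if the trivial solution $\xi\equiv0$ of the Hill equation $$\ddot{\xi}+a(t)\xi=0$$ is stable; equivalently, if all the solutions $\xi$ of this Hill equation are globally bounded (that is, $\sup_{t\ge0}|\xi(t)|<\infty$ for every solution). Torsional stability for the system with aerodynamic forces (the one with $\delta$-terms): in the torsional ($z_1$) equation, replacing $y_1$ by $\overline{y}$ and keeping only the terms linear in the torsional unknown together with the aerodynamic term gives the forced Hill equation $$\ddot{\xi}+a(t)\xi=f(t),\qquad f(t)=-\delta\,\dot{\overline{y}}(t).$$ The vertical mode $\overline{y}$ at energy $E(\eta_0,\eta_1)$ is called torsionally stable for this system if all the solutions $\xi$ of this forced Hill equation are globally bounded (that is, $\sup_{t\ge0}|\xi(t)|<\infty$ for every solution). *)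

theory Defs
  imports "HOL-Analysis.Analysis"
begin

section \<open>The two systems and the vertical mode\<close>

definition solves_ode2 :: "(real \<Rightarrow> real \<Rightarrow> real) \<Rightarrow> (real \<Rightarrow> real) \<Rightarrow> bool" where
  "solves_ode2 F x \<longleftrightarrow>
     (\<forall>t. x differentiable (at t) \<and> (deriv x has_real_derivative F t (x t)) (at t))"

text \<open>The case \<open>\<delta> = 0\<close> is the isolated system; \<open>\<delta> > 0\<close> adds the aerodynamic forces.\<close>

definition solves_system :: "real \<Rightarrow> (real \<Rightarrow> real) \<Rightarrow> (real \<Rightarrow> real) \<Rightarrow> bool" where
  "solves_system \<delta> y z \<longleftrightarrow>
     solves_ode2 (\<lambda>t u. - (3 * u + 3/2 * u^3 + 9/2 * u * (z t)^2 + \<delta> * deriv z t)) y \<and>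
     solves_ode2 (\<lambda>t u. - (7 * u + 9/2 * u^3 + 27/2 * u * (y t)^2 + \<delta> * deriv y t)) z"

definition vertical_mode :: "real \<Rightarrow> real \<Rightarrow> (real \<Rightarrow> real) \<Rightarrow> bool" where
  "vertical_mode \<eta>\<^sub>0 \<eta>\<^sub>1 y \<longleftrightarrow>
     solves_ode2 (\<lambda>t u. - (3 * u + 3/2 * u^3)) y \<and> y 0 = \<eta>\<^sub>0 \<and> deriv y 0 = \<eta>\<^sub>1"

definition energy :: "real \<Rightarrow> real \<Rightarrow> real" where
  "energy p q = q^2 / 2 + 3/2 * p^2 + 3/8 * p^4"

lemma vertical_mode_energy:
  assumes "vertical_mode \<eta>\<^sub>0 \<eta>\<^sub>1 y"
  shows "energy (y t) (deriv y t) = energy \<eta>\<^sub>0 \<eta>\<^sub>1"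
proof -
  have y: "(y has_real_derivative deriv y s) (at s)" for s
    using assms by (simp add: vertical_mode_def solves_ode2_def DERIV_deriv_iff_real_differentiable)
  have v: "(deriv y has_real_derivative - (3 * y s + 3/2 * (y s)^3)) (at s)" for s
    using assms by (simp add: vertical_mode_def solves_ode2_def)
  have "((\<lambda>s. energy (y s) (deriv y s)) has_real_derivative 0) (at s)" for s
    unfolding energy_def
    by (rule derivative_eq_intros y v refl | simp)+
       (simp add: algebra_simps power2_eq_square power3_eq_cube)
  hence "energy (y t) (deriv y t) = energy (y 0) (deriv y 0)"
    using DERIV_isconst_all by blast
  thus ?thesis
    using assms by (simp add: vertical_mode_def)
qed

lemma isolated_system_pure_vertical:
  "solves_system 0 y (\<lambda>_. 0) \<longleftrightarrow> solves_ode2 (\<lambda>t u. - (3 * u + 3/2 * u^3)) y"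
  by (simp add: solves_system_def solves_ode2_def)


section \<open>Torsional stability\<close>

definition hill_coeff :: "(real \<Rightarrow> real) \<Rightarrow> real \<Rightarrow> real" where
  "hill_coeff y t = 7 + 27/2 * (y t)^2"

text \<open>The Hill coefficient is the linearization at \<open>z = 0\<close> of the torsional restoring term.\<close>

lemma hill_coeff_linearization:
  "((\<lambda>z. 7 * z + 9/2 * z^3 + 27/2 * z * (y t)^2) has_real_derivative hill_coeff y t) (at 0)"
  unfolding hill_coeff_def by (rule derivative_eq_intros refl | simp)+

definition solves_hill :: "(real \<Rightarrow> real) \<Rightarrow> (real \<Rightarrow> real) \<Rightarrow> bool" where
  "solves_hill y \<xi> \<longleftrightarrow> solves_ode2 (\<lambda>t u. - (hill_coeff y t * u)) \<xi>"

definition solves_forced_hill :: "real \<Rightarrow> (real \<Rightarrow> real) \<Rightarrow> (real \<Rightarrow> real) \<Rightarrow> bool" where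
  "solves_forced_hill \<delta> y \<xi> \<longleftrightarrow>
     solves_ode2 (\<lambda>t u. - (hill_coeff y t * u) - \<delta> * deriv y t) \<xi>"

definition globally_bounded :: "(real \<Rightarrow> real) \<Rightarrow> bool" where
  "globally_bounded \<xi> \<longleftrightarrow> (\<exists>C. \<forall>t\<ge>0. \<bar>\<xi> t\<bar> \<le> C)"

text \<open>Lyapunov stability of the trivial solution of the Hill equation, in the phase plane.\<close>

definition torsionally_stable_isolated :: "(real \<Rightarrow> real) \<Rightarrow> bool" where
  "torsionally_stable_isolated y \<longleftrightarrow>
     (\<forall>\<epsilon>>0. \<exists>r>0. \<forall>\<xi>. solves_hill y \<xi> \<and> \<bar>\<xi> 0\<bar> < r \<and> \<bar>deriv \<xi> 0\<bar> < r \<longrightarrow>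
        (\<forall>t\<ge>0. \<bar>\<xi> t\<bar> < \<epsilon> \<and> \<bar>deriv \<xi> t\<bar> < \<epsilon>))"

definition torsionally_stable_aero :: "real \<Rightarrow> (real \<Rightarrow> real) \<Rightarrow> bool" where
  "torsionally_stable_aero \<delta> y \<longleftrightarrow> (\<forall>\<xi>. solves_forced_hill \<delta> y \<xi> \<longrightarrow> globally_bounded \<xi>)"

end

theory Submission
  imports Defs
begin

text \<open>
  Write \<open>a\<close> for the Hill coefficient, \<open>S\<close> for the translation by the half-period \<open>\<tau>\<close> of \<open>y\<close>, and
  call a solution of the unforced Hill equation homogeneous. Since \<open>a\<close> is bounded, a bounded
  homogeneous solution has bounded velocity, and stability of the trivial solution amounts to
  boundedness of all homogeneous solutions (\<open>isolated_stable_iff_solutions_bounded\<close>). Forced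
  solutions exist, and their differences are exactly the homogeneous solutions; so boundedness of
  the former implies boundedness of the latter.

  The converse is a question of resonance. The mode satisfies \<open>y (t + \<tau>) = - y t\<close>, so \<open>a\<close> is
  \<open>\<tau>\<close>-periodic, the forcing is \<open>\<tau>\<close>-antiperiodic, and a bounded particular solution exists as soon
  as \<open>S + 1\<close> is invertible on the homogeneous solutions: it then can be corrected to be antiperiodic
  (\<open>antiperiodic_forcing_bounded\<close>). As \<open>S\<close> has determinant 1, failure of invertibility means a double
  eigenvalue \<open>-1\<close>; a Jordan block would make a homogeneous solution grow linearly, so
  boundedness leaves only \<open>S = -1\<close>, where all homogeneous solutions are antiperiodic.

  This coexistence never happens (\<open>hill_equation_not_all_antiperiodic\<close>). Let \<open>p\<close> be a zero of \<open>y\<close> and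
  \<open>q > p\<close> the next zero of \<open>y'\<close>, so that \<open>\<tau> = 2 (q - p)\<close>. Under coexistence the homogeneous
  solution \<open>x\<close> with \<open>x q = 0\<close> is odd about \<open>q\<close> and hence even about \<open>p\<close>, that is \<open>x' p = 0\<close>. Two
  solutions of neighbouring equations have the same end conditions: \<open>y'\<close>, with the
  coefficient \<open>3 + 9/2 y\<^sup>2 < a\<close>, and \<open>y' (y\<^sup>2 - k)\<close>, which for a suitable \<open>k \<ge> 0\<close> has the coefficient
  \<open>27 + 21/2 k + 15 y\<^sup>2 > a\<close>. Comparison with the first forces a zero of \<open>x\<close> strictly between \<open>p\<close> and
  \<open>q\<close>; comparison with the second then forces two zeros of \<open>y' (y\<^sup>2 - k)\<close> there, but it has at
  most one because \<open>y\<close> moves monotonically from \<open>p\<close> to \<open>q\<close>.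

  For the mode \<open>y = 0\<close> the forcing vanishes and the two boundedness properties coincide.
\<close>

section \<open>Linear second-order equations: existence\<close>

text \<open>The velocity is an argument of its own, so that sums, translations and reflections of
  solutions are solutions by plain differentiation rules.\<close>

definition linear_ode2 ::
    "(real \<Rightarrow> real) \<Rightarrow> (real \<Rightarrow> real) \<Rightarrow> (real \<Rightarrow> real) \<Rightarrow> (real \<Rightarrow> real) \<Rightarrow> bool" where
  "linear_ode2 a f x v \<longleftrightarrow>
     (\<forall>t. (x has_real_derivative v t) (at t) \<and> (v has_real_derivative f t - a t * x t) (at t))"

definition primitive :: "(real \<Rightarrow> real) \<Rightarrow> real \<Rightarrow> real" where
  "primitive g = (SOME G. G 0 = 0 \<and> (\<forall>t. (G has_real_derivative g t) (at t)))"

lemma primitive: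
  assumes "continuous_on UNIV g"
  shows primitive_0: "primitive g 0 = 0"
    and primitive_deriv: "(primitive g has_real_derivative g t) (at t)"
proof -
  have "\<exists>G. \<forall>t::real. -\<infinity> < ereal t \<longrightarrow> ereal t < \<infinity> \<longrightarrow> (G has_vector_derivative g t) (at t)"
    by (rule einterval_antiderivative) (use assms in \<open>auto simp: continuous_on_eq_continuous_at\<close>)
  then obtain G where "\<And>t. (G has_real_derivative g t) (at t)"
    by (auto simp: has_real_derivative_iff_has_vector_derivative)
  then have "\<exists>G. G 0 = 0 \<and> (\<forall>t. (G has_real_derivative g t) (at t))"
    by (intro exI[of _ "\<lambda>t. G t - G 0"]) (auto intro!: derivative_eq_intros)
  from someI_ex[OF this] show "primitive g 0 = 0"
    and "(primitive g has_real_derivative g t) (at t)"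
    unfolding primitive_def by auto
qed

lemma continuous_on_primitive:
  "continuous_on UNIV g \<Longrightarrow> continuous_on UNIV (primitive g)"
  by (meson DERIV_continuous_on has_field_derivative_at_within primitive_deriv)

text \<open>This estimate drives the Picard iteration: each integration raises the power of \<open>t\<close> and
  produces the factorial that makes the series converge.\<close>

lemma primitive_bound:
  fixes G g :: "real \<Rightarrow> real"
  assumes G0: "G 0 = 0" and G: "\<And>t. (G has_real_derivative g t) (at t)"
    and b: "\<And>t. \<bar>t\<bar> \<le> R \<Longrightarrow> \<bar>g t\<bar> \<le> C * \<bar>t\<bar> ^ k / fact k"
    and t: "\<bar>t\<bar> \<le> R"
  shows "\<bar>G t\<bar> \<le> C * \<bar>t\<bar> ^ Suc k / fact (Suc k)"
proof -
  have pos: "H s \<le> C * s ^ Suc k / fact (Suc k)"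
    if H0: "H 0 = 0" and H: "\<And>t. (H has_real_derivative h t) (at t)"
      and h: "\<And>t. \<lbrakk>0 \<le> t; t \<le> R\<rbrakk> \<Longrightarrow> h t \<le> C * t ^ k / fact k" and s: "0 \<le> s" "s \<le> R"
    for H h :: "real \<Rightarrow> real" and s
  proof -
    define D where "D t = C * t ^ Suc k / fact (Suc k) - H t" for t
    have "D 0 \<le> D s"
    proof (rule DERIV_nonneg_imp_nondecreasing[OF s(1)])
      fix u assume u: "0 \<le> u" "u \<le> s"
      have "(D has_real_derivative C * (real (Suc k) * u ^ k) / fact (Suc k) - h u) (at u)"
        unfolding D_def by (rule derivative_eq_intros H refl | simp)+
      moreover have "C * (real (Suc k) * u ^ k) / fact (Suc k) = C * u ^ k / fact k"
        by (simp add: fact_Suc del: of_nat_Suc)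
      ultimately show "\<exists>y. (D has_real_derivative y) (at u) \<and> 0 \<le> y"
        using h[of u] u s by (intro exI[of _ "C * u ^ k / fact k - h u"]) auto
    qed
    then show ?thesis by (simp add: D_def H0)
  qed
  have neg: "((\<lambda>t. c * G (e * t)) has_real_derivative c * (g (e * t) * e)) (at t)" for c e t
    by (rule derivative_eq_intros G DERIV_chain2[where f=G] refl | simp)+
  have *: "c * G (e * \<bar>t\<bar>) \<le> C * \<bar>t\<bar> ^ Suc k / fact (Suc k)" if "\<bar>c\<bar> = 1" "\<bar>e\<bar> = 1" for c e
  proof (rule pos[of "\<lambda>t. c * G (e * t)", OF _ neg])
    fix u assume u: "0 \<le> u" "u \<le> R"
    have "c * (g (e * u) * e) \<le> \<bar>g (e * u)\<bar>"
      using that by (metis abs_ge_self abs_mult mult.right_neutral mult_1)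
    also have "\<dots> \<le> C * u ^ k / fact k"
      using b[of "e * u"] that u by (simp add: abs_mult)
    finally show "c * (g (e * u) * e) \<le> C * u ^ k / fact k" .
  qed (use G0 t in auto)
  show ?thesis
    using *[of 1 1] *[of 1 "-1"] *[of "-1" 1] *[of "-1" "-1"]
    by (cases "0 \<le> t") auto
qed

text \<open>Picard iteration, written as a series: \<open>U 0\<close> solves \<open>x'' = f\<close> with the given initial data, and the
  correction \<open>U (Suc n)\<close> solves \<open>x'' = - a U n\<close> with zero initial data, so \<open>\<Sum>n. U n\<close> telescopes to a
  solution. On a bounded interval the terms and their first two derivatives \<open>V n\<close>, \<open>W n\<close> are dominated by
  an exponential series, which permits termwise differentiation.\<close>

lemma linear_ode2_exists_0:
  fixes a f :: "real \<Rightarrow> real"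
  assumes a: "continuous_on UNIV a" and f: "continuous_on UNIV f"
  shows "\<exists>x v. linear_ode2 a f x v \<and> x 0 = x0 \<and> v 0 = v0"
proof -
  define U where "U = rec_nat (\<lambda>t. x0 + v0 * t + primitive (primitive f) t)
    (\<lambda>_ u t. - primitive (primitive (\<lambda>s. a s * u s)) t)"
  define V where "V n = (case n of 0 \<Rightarrow> (\<lambda>t. v0 + primitive f t)
    | Suc m \<Rightarrow> (\<lambda>t. - primitive (\<lambda>s. a s * U m s) t))" for n
  define W where "W n = (case n of 0 \<Rightarrow> f | Suc m \<Rightarrow> (\<lambda>t. - (a t * U m t)))" for n
  have U0: "U 0 = (\<lambda>t. x0 + v0 * t + primitive (primitive f) t)"
    and US: "U (Suc n) = (\<lambda>t. - primitive (primitive (\<lambda>s. a s * U n s)) t)" for n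
    by (simp_all add: U_def)
  have Ucont: "continuous_on UNIV (U n)" for n
    by (induction n) (auto simp: U0 US intro!: continuous_intros continuous_on_primitive a f)
  have aU: "continuous_on UNIV (\<lambda>s. a s * U n s)" for n
    by (intro continuous_intros a Ucont)
  have dU: "(U n has_real_derivative V n t) (at t)" for n t
    by (cases n) (auto simp: U0 US V_def intro!: derivative_eq_intros primitive_deriv
        continuous_on_primitive f aU)
  have dV: "(V n has_real_derivative W n t) (at t)" for n t
    by (cases n) (auto simp: V_def W_def intro!: derivative_eq_intros primitive_deriv f aU)
  have Vcont: "continuous_on UNIV (V n)" for n
    by (meson dV DERIV_continuous_on has_field_derivative_at_within)
  have main: "summable (\<lambda>n. U n t) \<and> summable (\<lambda>n. V n t) \<and>
      ((\<lambda>t. \<Sum>n. U n t) has_real_derivative (\<Sum>n. V n t)) (at t) \<and>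
      ((\<lambda>t. \<Sum>n. V n t) has_real_derivative (\<Sum>n. W n t)) (at t)" for t
  proof -
    \<comment> \<open>A compact interval with \<open>t\<close> in its interior; \<open>R \<ge> 1\<close> absorbs spare powers of \<open>R\<close>.\<close>
    define R where "R = \<bar>t\<bar> + 1"
    have R: "R \<ge> 1" by (simp add: R_def)
    let ?S = "cball 0 R :: real set"
    have bdd: "\<exists>B\<ge>1. \<forall>s\<in>?S. \<bar>g s\<bar> \<le> B" if g: "continuous_on UNIV g" for g :: "real \<Rightarrow> real"
    proof -
      have "bounded (g ` ?S)"
        using g by (meson compact_cball compact_continuous_image compact_imp_bounded
            continuous_on_subset subset_UNIV)
      then obtain B where "\<forall>x\<in>g ` ?S. norm x \<le> B" unfolding bounded_iff by blast
      then show ?thesis by (intro exI[of _ "max B 1"]) auto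
    qed
    obtain K where K: "K \<ge> 1" "\<And>s. s \<in> ?S \<Longrightarrow> \<bar>a s\<bar> \<le> K" using bdd[OF a] by blast
    obtain C1 C2 C3 where C123: "\<forall>s\<in>?S. \<bar>f s\<bar> \<le> C1" "\<forall>s\<in>?S. \<bar>U 0 s\<bar> \<le> C2"
      "\<forall>s\<in>?S. \<bar>V 0 s\<bar> \<le> C3" "C1 \<ge> 1" "C2 \<ge> 1" "C3 \<ge> 1"
      using bdd[OF f] bdd[OF Ucont] bdd[OF Vcont] by meson
    define C where "C = C1 + C2 + C3"
    have C: "C \<ge> 0" "\<And>s. s \<in> ?S \<Longrightarrow> \<bar>f s\<bar> \<le> C" "\<And>s. s \<in> ?S \<Longrightarrow> \<bar>U 0 s\<bar> \<le> C"
      "\<And>s. s \<in> ?S \<Longrightarrow> \<bar>V 0 s\<bar> \<le> C"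
      using C123 by (force simp: C_def)+
    have step: "\<bar>a s * U n s\<bar> \<le> (K * (C * (K * R) ^ n)) * \<bar>s\<bar> ^ n / fact n"
      if "\<bar>U n s\<bar> \<le> C * (K * R) ^ n * \<bar>s\<bar> ^ n / fact n" "\<bar>s\<bar> \<le> R" for n s
    proof -
      have "\<bar>a s * U n s\<bar> = \<bar>a s\<bar> * \<bar>U n s\<bar>" by (simp add: abs_mult)
      also have "\<dots> \<le> K * (C * (K * R) ^ n * \<bar>s\<bar> ^ n / fact n)"
        using that K by (intro mult_mono) auto
      finally show ?thesis by (simp add: mult_ac)
    qed
    \<comment> \<open>Two integrations gain \<open>\<bar>s\<bar>\<^sup>2\<close>; one factor is sacrificed to \<open>R\<close>, so the plain exponential series dominates.\<close>
    have Ub: "\<bar>U n s\<bar> \<le> C * (K * R) ^ n * \<bar>s\<bar> ^ n / fact n" if "\<bar>s\<bar> \<le> R" for n s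
      using that
    proof (induction n arbitrary: s)
      case 0
      then show ?case using C by simp
    next
      case (Suc n)
      let ?p = "primitive (\<lambda>s. a s * U n s)"
      let ?D = "K * (C * (K * R) ^ n)"
      have pc: "continuous_on UNIV ?p" by (intro continuous_on_primitive aU)
      have 1: "\<bar>?p u\<bar> \<le> ?D * \<bar>u\<bar> ^ Suc n / fact (Suc n)" if "\<bar>u\<bar> \<le> R" for u
        by (rule primitive_bound[OF primitive_0 primitive_deriv, OF aU aU step[OF Suc.IH] that]) auto
      have 2: "\<bar>primitive ?p s\<bar> \<le> ?D * \<bar>s\<bar> ^ Suc (Suc n) / fact (Suc (Suc n))"
        by (rule primitive_bound[OF primitive_0 primitive_deriv, OF pc pc 1 Suc.prems])
      have D: "?D \<ge> 0" using C K R by auto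
      have "?D * \<bar>s\<bar> ^ Suc (Suc n) / fact (Suc (Suc n)) \<le> ?D * (R * \<bar>s\<bar> ^ Suc n) / fact (Suc n)"
        using C K Suc.prems R
        by (intro frac_le mult_left_mono mult_nonneg_nonneg) (auto intro!: mult_right_mono fact_mono)
      also have "\<dots> = C * (K * R) ^ Suc n * \<bar>s\<bar> ^ Suc n / fact (Suc n)"
        by (simp add: mult_ac)
      finally show ?case using 2 by (simp add: US)
    qed
    define M where "M n = (C * K) * ((K * R * R) ^ n /\<^sub>R fact n)" for n
    have M: "summable M" unfolding M_def by (intro summable_mult summable_exp_generic)
    have M0: "0 \<le> M n" for n using C K R by (simp add: M_def)
    have pw: "\<bar>s\<bar> ^ n \<le> R ^ n" if "\<bar>s\<bar> \<le> R" for s n using that by (intro power_mono) auto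
    have UM: "\<bar>U n s\<bar> \<le> M n" if "\<bar>s\<bar> \<le> R" for n s
    proof -
      have "\<bar>U n s\<bar> \<le> 1 * (C * (K * R) ^ n * R ^ n / fact n)"
        using Ub[OF that, of n] pw[OF that, of n] C K R
        by (smt (verit) divide_right_mono mult_left_mono mult_nonneg_nonneg zero_le_power fact_ge_zero)
      also have "\<dots> \<le> K * (C * (K * R) ^ n * R ^ n / fact n)"
        using C K R by (intro mult_right_mono) auto
      finally show ?thesis by (simp add: M_def power_mult_distrib divide_inverse mult_ac)
    qed
    have WM: "\<bar>W (Suc n) s\<bar> \<le> M n" if "\<bar>s\<bar> \<le> R" for n s
    proof -
      have "\<bar>a s * U n s\<bar> \<le> (K * (C * (K * R) ^ n)) * R ^ n / fact n"
        using step[OF Ub[OF that] that, of n] pw[OF that, of n] C K R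
        by (smt (verit) divide_right_mono mult_left_mono mult_nonneg_nonneg zero_le_power fact_ge_zero)
      then show ?thesis by (simp add: M_def W_def power_mult_distrib divide_inverse mult_ac)
    qed
    have VM: "\<bar>V (Suc n) s\<bar> \<le> R * M n" if "\<bar>s\<bar> \<le> R" for n s
    proof -
      have "\<bar>V (Suc n) s\<bar> \<le> M n * \<bar>s\<bar> ^ Suc 0 / fact (Suc 0)"
        using WM that
        by (intro primitive_bound[of _ "W (Suc n)" R] dV) (auto simp: V_def primitive_0 aU)
      also have "\<dots> \<le> R * M n" using that M0[of n] by (simp add: mult_right_mono mult.commute[of "M n"])
      finally show ?thesis .
    qed
    have shift: "uniformly_convergent_on ?S (\<lambda>n x. \<Sum>i<n. h i x)"
      if "\<And>n s. \<bar>s\<bar> \<le> R \<Longrightarrow> \<bar>h (Suc n) s\<bar> \<le> R * M n" "\<And>s. \<bar>s\<bar> \<le> R \<Longrightarrow> \<bar>h 0 s\<bar> \<le> C"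
      for h :: "nat \<Rightarrow> real \<Rightarrow> real"
    proof (rule Weierstrass_m_test'[where M="\<lambda>n. case n of 0 \<Rightarrow> C | Suc m \<Rightarrow> R * M m"])
      show "summable (\<lambda>n. case n of 0 \<Rightarrow> C | Suc m \<Rightarrow> R * M m)"
        by (subst summable_Suc_iff[symmetric]) (simp add: M summable_mult)
      show "norm (h n x) \<le> (case n of 0 \<Rightarrow> C | Suc m \<Rightarrow> R * M m)" if "x \<in> ?S" for n x
        using that \<open>\<And>n s. \<bar>s\<bar> \<le> R \<Longrightarrow> \<bar>h (Suc n) s\<bar> \<le> R * M n\<close>
          \<open>\<And>s. \<bar>s\<bar> \<le> R \<Longrightarrow> \<bar>h 0 s\<bar> \<le> C\<close> by (cases n) auto
    qed
    have Vu: "uniformly_convergent_on ?S (\<lambda>n x. \<Sum>i<n. V i x)"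
      using VM C by (intro shift) auto
    have Wu: "uniformly_convergent_on ?S (\<lambda>n x. \<Sum>i<n. W i x)"
    proof (intro shift)
      fix n s assume s: "\<bar>s\<bar> \<le> R"
      have "1 * M n \<le> R * M n" using R M0 by (intro mult_right_mono) auto
      then show "\<bar>W (Suc n) s\<bar> \<le> R * M n" using WM[OF s, of n] by simp
    qed (use C in \<open>auto simp: W_def\<close>)
    have t: "t \<in> interior ?S" by (simp add: R_def)
    have sU: "summable (\<lambda>n. U n 0)"
      by (rule summable_comparison_test'[OF M, of 0]) (use UM R in auto)
    have sV: "summable (\<lambda>n. V n 0)"
      by (subst summable_Suc_iff[symmetric]) (simp add: V_def primitive_0 aU)
    note 1 = has_field_derivative_series'[OF convex_cball has_field_derivative_at_within[OF dU] Vu _ sU t]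
    note 2 = has_field_derivative_series'[OF convex_cball has_field_derivative_at_within[OF dV] Wu _ sV t]
    show ?thesis using 1 2 R by auto
  qed
  define x where "x t = (\<Sum>n. U n t)" for t
  define v where "v t = (\<Sum>n. V n t)" for t
  have "(\<Sum>n. W n t) = f t - a t * x t" for t
  proof -
    have "(\<lambda>n. - (a t * U n t)) sums (- (a t * x t))"
      unfolding x_def using main[of t] by (intro sums_minus sums_mult summable_sums) auto
    then have "(\<lambda>n. W (Suc n) t) sums (- (a t * x t))" by (simp add: W_def)
    from sums_Suc[OF this] show ?thesis by (simp add: sums_iff W_def)
  qed
  then have "linear_ode2 a f x v"
    using main unfolding linear_ode2_def x_def[abs_def] v_def[abs_def] by auto
  moreover have "x 0 = x0"
  proof -
    have "U n 0 = (if n = 0 then x0 else 0)" for n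
      by (cases n) (auto simp: U0 US primitive_0 continuous_on_primitive f aU)
    then show ?thesis unfolding x_def by (subst suminf_finite[of "{0}"]) auto
  qed
  moreover have "v 0 = v0"
  proof -
    have "V n 0 = (if n = 0 then v0 else 0)" for n
      by (cases n) (auto simp: V_def primitive_0 f aU)
    then show ?thesis unfolding v_def by (subst suminf_finite[of "{0}"]) auto
  qed
  ultimately show ?thesis by blast
qed

section \<open>Linear second-order equations: structure of the solution space\<close>

lemma linear_ode2_combine:
  assumes "linear_ode2 a f x v" and "linear_ode2 a g z w"
  shows "linear_ode2 a (\<lambda>t. c * f t + d * g t) (\<lambda>t. c * x t + d * z t) (\<lambda>t. c * v t + d * w t)"
proof -
  have x: "(x has_real_derivative v t) (at t)" "(v has_real_derivative f t - a t * x t) (at t)"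
    and z: "(z has_real_derivative w t) (at t)" "(w has_real_derivative g t - a t * z t) (at t)" for t
    using assms by (auto simp: linear_ode2_def)
  show ?thesis
    unfolding linear_ode2_def
    by (auto intro!: derivative_eq_intros x z simp: algebra_simps)
qed

lemma linear_ode2_combine_homogeneous:
  assumes "linear_ode2 a (\<lambda>_. 0) x v" and "linear_ode2 a (\<lambda>_. 0) z w"
  shows "linear_ode2 a (\<lambda>_. 0) (\<lambda>t. c * x t + d * z t) (\<lambda>t. c * v t + d * w t)"
  using linear_ode2_combine[OF assms, of c d] by simp

text \<open>With \<open>e = 1\<close> this is a translation in time, with \<open>e = -1\<close> a reflection.\<close>

lemma linear_ode2_affine:
  assumes "linear_ode2 a f x v" and "e * e = 1"
  shows "linear_ode2 (\<lambda>t. a (s + e * t)) (\<lambda>t. f (s + e * t)) (\<lambda>t. x (s + e * t)) (\<lambda>t. e * v (s + e * t))"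
proof -
  have x: "(x has_real_derivative v t) (at t)" "(v has_real_derivative f t - a t * x t) (at t)" for t
    using assms by (auto simp: linear_ode2_def)
  have 1: "((\<lambda>t. x (s + e * t)) has_real_derivative v (s + e * t) * e) (at t)"
    and 2: "((\<lambda>t. v (s + e * t)) has_real_derivative
        (f (s + e * t) - a (s + e * t) * x (s + e * t)) * e) (at t)" for t
    by (rule DERIV_chain2[OF x(1)] DERIV_chain2[OF x(2)] derivative_eq_intros refl | simp)+
  have "e * (A * e) = A" for A using assms(2) by (metis mult.left_commute mult.right_neutral)
  with DERIV_cmult[OF 2, of e] 1 show ?thesis by (simp add: linear_ode2_def mult.commute[of e "v _"])
qed

lemma linear_ode2_exists:
  assumes a: "continuous_on UNIV a" and f: "continuous_on UNIV f"
  obtains x v where "linear_ode2 a f x v" "x s = x0" "v s = v0"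
proof -
  have c: "continuous_on UNIV (\<lambda>t. g (s + 1 * t))" if "continuous_on UNIV g" for g :: "real \<Rightarrow> real"
    by (rule continuous_on_compose2[OF that]) (auto intro!: continuous_intros)
  obtain x v where "linear_ode2 (\<lambda>t. a (s + 1 * t)) (\<lambda>t. f (s + 1 * t)) x v" "x 0 = x0" "v 0 = v0"
    using linear_ode2_exists_0[OF c[OF a] c[OF f]] by blast
  with linear_ode2_affine[OF this(1), of 1 "-s"]
  show ?thesis by (intro that[of "\<lambda>t. x (t - s)" "\<lambda>t. v (t - s)"]) auto
qed

lemma wronskian_deriv:
  assumes "linear_ode2 a (\<lambda>_. 0) x v" and "linear_ode2 b (\<lambda>_. 0) z w"
  shows "((\<lambda>t. v t * z t - x t * w t) has_real_derivative (b t - a t) * (x t * z t)) (at t)"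
proof -
  have x: "(x has_real_derivative v t) (at t)" "(v has_real_derivative 0 - a t * x t) (at t)"
    and z: "(z has_real_derivative w t) (at t)" "(w has_real_derivative 0 - b t * z t) (at t)"
    using assms by (auto simp: linear_ode2_def)
  show ?thesis
    by (rule derivative_eq_intros x z refl | simp add: algebra_simps)+
qed

lemma wronskian_const:
  assumes "linear_ode2 a (\<lambda>_. 0) x v" and "linear_ode2 a (\<lambda>_. 0) z w"
  shows "v t * z t - x t * w t = v s * z s - x s * w s"
  using wronskian_deriv[OF assms] by (intro DERIV_isconst_all) simp

lemma linear_ode2_velocity_unique:
  assumes "linear_ode2 a f x v" and "linear_ode2 b g x w"
  shows "v = w"
  using assms DERIV_unique unfolding linear_ode2_def by blast

text \<open>Pairing \<open>x\<close> with the solution that has data \<open>(0, 1)\<close> at \<open>t\<close>, the constant Wronskian reads off \<open>- x t\<close>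
  at time \<open>t\<close> and vanishes at time \<open>s\<close>: uniqueness follows from existence.\<close>

lemma linear_ode2_trivial:
  assumes a: "continuous_on UNIV a" and x: "linear_ode2 a (\<lambda>_. 0) x v"
    and "x s = 0" "v s = 0"
  shows "x t = 0"
proof -
  obtain z w where z: "linear_ode2 a (\<lambda>_. 0) z w" "z t = 0" "w t = 1"
    using linear_ode2_exists[OF a] continuous_on_const by metis
  show ?thesis using wronskian_const[OF x z(1), of t s] assms z by simp
qed

lemma linear_ode2_unique:
  assumes a: "continuous_on UNIV a"
    and x: "linear_ode2 a f x v" and z: "linear_ode2 a f z w"
    and "x s = z s" "v s = w s"
  shows "x = z" "v = w"
proof -
  have "linear_ode2 a (\<lambda>_. 0) (\<lambda>t. x t - z t) (\<lambda>t. v t - w t)"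
    using linear_ode2_combine[OF x z, of 1 "-1"] by simp
  from linear_ode2_trivial[OF a this, of s] assms show "x = z" by auto
  with x z show "v = w" using linear_ode2_velocity_unique by blast
qed

lemma linear_ode2_continuous:
  assumes "linear_ode2 a f x v"
  shows "continuous_on S x" "continuous_on S v"
proof -
  have "isCont x t" "isCont v t" for t
    using assms DERIV_isCont[of x "v t" t] DERIV_isCont[of v _ t] unfolding linear_ode2_def by auto
  then show "continuous_on S x" "continuous_on S v"
    by (auto intro: continuous_at_imp_continuous_on)
qed

section \<open>Zeros of solutions\<close>

lemma Rolle_derivative:
  fixes f g :: "real \<Rightarrow> real"
  assumes f: "\<And>t. (f has_real_derivative g t) (at t)" and "p < q" "f p = f q"
  obtains t where "p < t" "t < q" "g t = 0"
proof -
  have "continuous_on {p..q} f"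
    using DERIV_isCont[OF f] by (intro continuous_at_imp_continuous_on) auto
  moreover have "f differentiable (at t)" for t
    using f[of t] by (auto simp: real_differentiable_def)
  ultimately obtain t where "p < t" "t < q" "(f has_real_derivative 0) (at t)"
    using Rolle[OF assms(2,3)] by blast
  then show ?thesis using that DERIV_unique[OF f[of t]] by blast
qed

text \<open>Zeros of a function with nonvanishing data \<open>(x p, v p)\<close> do not accumulate at \<open>p\<close>, so the
  zeros after \<open>p\<close> have a smallest element.\<close>

lemma first_zero:
  fixes x :: "real \<Rightarrow> real"
  assumes x: "\<And>t. (x has_real_derivative v t) (at t)"
    and p: "x p \<noteq> 0 \<or> v p \<noteq> 0" and "p < q" "x q = 0"
  obtains r where "p < r" "r \<le> q" "x r = 0" "\<And>t. p < t \<Longrightarrow> t < r \<Longrightarrow> x t \<noteq> 0"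
proof -
  obtain d where d: "d > 0" "\<And>t. p < t \<Longrightarrow> t < p + d \<Longrightarrow> x t \<noteq> 0"
  proof (cases "x p = 0")
    case True
    with p consider "v p > 0" | "v p < 0" by linarith
    then show ?thesis
    proof cases
      case 1
      from DERIV_pos_inc_right[OF x this] obtain d where
        d: "d > 0" "\<forall>h>0. h < d \<longrightarrow> x p < x (p + h)" by blast
      have "x t \<noteq> 0" if "p < t" "t < p + d" for t
        using d(2)[rule_format, of "t - p"] that True by simp
      with d(1) show ?thesis by (rule that)
    next
      case 2
      from DERIV_neg_dec_right[OF x this] obtain d where
        d: "d > 0" "\<forall>h>0. h < d \<longrightarrow> x p > x (p + h)" by blast
      have "x t \<noteq> 0" if "p < t" "t < p + d" for t
        using d(2)[rule_format, of "t - p"] that True by simp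
      with d(1) show ?thesis by (rule that)
    qed
  next
    case False
    from continuous_at_avoid[OF DERIV_isCont[OF x] False] obtain d where
      d: "d > 0" "\<forall>t. dist p t < d \<longrightarrow> x t \<noteq> 0" by blast
    have "x t \<noteq> 0" if "p < t" "t < p + d" for t
      using d(2)[rule_format, of t] that by (simp add: dist_real_def)
    with d(1) show ?thesis by (rule that)
  qed
  have q: "p + d \<le> q" using d(2)[of q] \<open>p < q\<close> \<open>x q = 0\<close> by (metis not_le)
  let ?Z = "{p + d/2..q} \<inter> x -` {0}"
  have "compact ?Z"
    using DERIV_isCont[OF x]
    by (rule compact_Int_closed[OF compact_Icc continuous_closed_vimage[OF closed_singleton]])
  moreover have "q \<in> ?Z" using q d(1) \<open>x q = 0\<close> by simp
  ultimately obtain r where r: "r \<in> ?Z" "\<forall>t\<in>?Z. r \<le> t"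
    using compact_attains_inf[of ?Z] by blast
  show ?thesis
  proof (rule that)
    show "p < r" "r \<le> q" "x r = 0" using r(1) d(1) by auto
    show "x t \<noteq> 0" if t: "p < t" "t < r" for t
    proof
      assume 0: "x t = 0"
      with d(2)[OF t(1)] d(1) have "t \<ge> p + d/2" by linarith
      with 0 t r show False by force
    qed
  qed
qed

lemma nonzero_imp_constant_sign:
  fixes x :: "real \<Rightarrow> real"
  assumes "continuous_on UNIV x" and nz: "\<And>t. t \<in> {p<..<q} \<Longrightarrow> x t \<noteq> 0"
  shows "\<exists>e. (e = 1 \<or> e = -1) \<and> (\<forall>t\<in>{p<..<q}. e * x t > 0)"
proof -
  have "connected (x ` {p<..<q})"
    using assms(1) by (intro connected_continuous_image) (auto intro: continuous_on_subset)
  then have *: "0 \<in> x ` {p<..<q}" if "s \<in> {p<..<q}" "t \<in> {p<..<q}" "x s < 0" "x t > 0" for s t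
    using that unfolding connected_iff_interval by (meson imageI less_imp_le)
  show ?thesis
  proof (cases "\<exists>t\<in>{p<..<q}. x t > 0")
    case True
    then show ?thesis using * nz by (intro exI[of _ 1]) (force simp: not_less)
  next
    case False
    then show ?thesis using nz by (intro exI[of _ "-1"]) force
  qed
qed

text \<open>Sturm's comparison theorem. If \<open>z\<close> had no zero, then after sign changes \<open>x\<close> and \<open>z\<close> would be
  positive, and the Wronskian, whose derivative is \<open>(b - a) x z\<close>, would increase from a nonnegative
  to a nonpositive value. The end \<open>p\<close> may carry a Dirichlet condition on \<open>x\<close> or a Neumann
  condition on both functions.\<close>

lemma sturm_comparison:
  assumes x: "linear_ode2 a (\<lambda>_. 0) x v" and z: "linear_ode2 b (\<lambda>_. 0) z w"
    and pq: "p < q" and ab: "\<And>t. t \<in> {p<..<q} \<Longrightarrow> a t < b t"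
    and nz: "\<And>t. t \<in> {p<..<q} \<Longrightarrow> x t \<noteq> 0" and xq: "x q = 0"
    and left: "x p = 0 \<or> v p = 0 \<and> w p = 0"
  shows "\<exists>t\<in>{p<..<q}. z t = 0"
proof (rule ccontr)
  assume "\<not> ?thesis"
  then have zn: "\<And>t. t \<in> {p<..<q} \<Longrightarrow> z t \<noteq> 0" by blast
  obtain e where e: "e = 1 \<or> e = -1" "\<And>t. t \<in> {p<..<q} \<Longrightarrow> e * x t > 0"
    using nonzero_imp_constant_sign[OF linear_ode2_continuous(1)[OF x] nz] by blast
  obtain d where d: "d = 1 \<or> d = -1" "\<And>t. t \<in> {p<..<q} \<Longrightarrow> d * z t > 0"
    using nonzero_imp_constant_sign[OF linear_ode2_continuous(1)[OF z] zn] by blast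
  define X V Z W where "X t = e * x t" and "V t = e * v t" and "Z t = d * z t" and "W t = d * w t" for t
  have X: "linear_ode2 a (\<lambda>_. 0) X V" and Z: "linear_ode2 b (\<lambda>_. 0) Z W"
    unfolding X_def V_def Z_def W_def
    using linear_ode2_combine_homogeneous[OF x x, of e 0] linear_ode2_combine_homogeneous[OF z z, of d 0]
    by simp_all
  have pos: "X t > 0" "Z t > 0" if "t \<in> {p<..<q}" for t
    using e d that by (auto simp: X_def Z_def)
  have dX: "(X has_real_derivative V t) (at t)" for t using X by (simp add: linear_ode2_def)
  have Zend: "Z p \<ge> 0" "Z q \<ge> 0"
  proof -
    have "Z ` closure {p<..<q} \<subseteq> {0..}"
      by (rule image_closure_subset[OF linear_ode2_continuous(1)[OF Z]]) (use pos in \<open>force+\<close>)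
    then show "Z p \<ge> 0" "Z q \<ge> 0" using pq by (auto simp: image_subset_iff)
  qed
  have Vq: "V q \<le> 0"
  proof (rule ccontr)
    assume "\<not> V q \<le> 0"
    then obtain h where h: "h > 0" "\<forall>k>0. k < h \<longrightarrow> X (q - k) < X q"
      using DERIV_pos_inc_left[OF dX, of q] by force
    obtain k where k: "0 < k" "k < h" "k < q - p"
      using field_lbound_gt_zero[of h "q - p"] h pq by auto
    have "X (q - k) < 0" using h(2)[rule_format, OF k(1,2)] xq by (simp add: X_def)
    moreover have "X (q - k) > 0" using k by (intro pos) auto
    ultimately show False by simp
  qed
  have Vp: "V p \<ge> 0" if "x p = 0"
  proof (rule ccontr)
    assume "\<not> V p \<ge> 0"
    then obtain h where h: "h > 0" "\<forall>k>0. k < h \<longrightarrow> X p > X (p + k)"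
      using DERIV_neg_dec_right[OF dX, of p] by force
    obtain k where k: "0 < k" "k < h" "k < q - p"
      using field_lbound_gt_zero[of h "q - p"] h pq by auto
    have "X (p + k) < 0" using h(2)[rule_format, OF k(1,2)] that by (simp add: X_def)
    moreover have "X (p + k) > 0" using k by (intro pos) auto
    ultimately show False by simp
  qed
  let ?D = "\<lambda>t. V t * Z t - X t * W t"
  have "?D p < ?D q"
  proof (rule DERIV_pos_imp_increasing_open[OF pq])
    fix t assume "p < t" "t < q"
    then show "\<exists>y. (?D has_real_derivative y) (at t) \<and> 0 < y"
      using wronskian_deriv[OF X Z, of t] ab[of t] pos[of t] by auto
  qed (intro continuous_intros linear_ode2_continuous[OF X] linear_ode2_continuous[OF Z])
  moreover have "?D p \<ge> 0"
    using left Vp Zend by (auto simp: X_def V_def W_def)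
  moreover have "?D q \<le> 0"
    using Vq Zend xq by (simp add: X_def mult_nonpos_nonneg)
  ultimately show False by linarith
qed

text \<open>The comparison function is \<open>sin (t - p)\<close>.\<close>

lemma zero_in_interval_pi:
  assumes z: "linear_ode2 b (\<lambda>_. 0) z w" and b: "\<And>t. b t > 1"
  obtains t where "p < t" "t < p + pi" "z t = 0"
proof -
  have s: "linear_ode2 (\<lambda>_. 1) (\<lambda>_. 0) (\<lambda>t. sin (t - p)) (\<lambda>t. cos (t - p))"
    unfolding linear_ode2_def by (auto intro!: derivative_eq_intros)
  have "\<exists>t\<in>{p<..<p + pi}. z t = 0"
  proof (rule sturm_comparison[OF s z])
    show "sin (t - p) \<noteq> 0" if "t \<in> {p<..<p + pi}" for t
      using sin_gt_zero[of "t - p"] that by simp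
  qed (use b in auto)
  then show ?thesis using that by auto
qed

section \<open>The vertical mode and its symmetries\<close>

locale duffing =
  fixes y v :: "real \<Rightarrow> real"
  assumes dy: "(y has_real_derivative v t) (at t)"
    and dv: "(v has_real_derivative - (3 * y t + 3/2 * (y t)^3)) (at t)"

lemma duffing_affine:
  assumes "duffing y v" and "c * c = 1" "e * e = 1"
  shows "duffing (\<lambda>t. c * y (s + e * t)) (\<lambda>t. c * e * v (s + e * t))"
proof -
  interpret duffing y v by fact
  have c: "c = 1 \<or> c = -1" and e: "e = 1 \<or> e = -1"
    using assms by (simp_all add: square_eq_1_iff)
  have 1: "((\<lambda>t. y (s + e * t)) has_real_derivative v (s + e * t) * e) (at t)"
    and 2: "((\<lambda>t. v (s + e * t)) has_real_derivative
        - (3 * y (s + e * t) + 3/2 * (y (s + e * t))^3) * e) (at t)" for t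
    by (rule DERIV_chain2[OF dy] DERIV_chain2[OF dv] derivative_eq_intros refl | simp)+
  show ?thesis
    using c e DERIV_cmult[OF 1, of c] DERIV_cmult[OF 2, of "c * e"]
    by unfold_locales (auto simp: algebra_simps)
qed

text \<open>The difference of two solutions solves a linear equation, whose coefficient comes from
  factoring \<open>y - z\<close> out of \<open>y\<^sup>3 - z\<^sup>3\<close>; so linear uniqueness applies to this nonlinear equation.\<close>

lemma duffing_unique:
  assumes "duffing y v" "duffing z w" and s: "y s = z s" "v s = w s"
  shows "y t = z t"
proof -
  interpret Y: duffing y v by fact
  interpret Z: duffing z w by fact
  let ?a = "\<lambda>t. 3 + 3/2 * ((y t)^2 + y t * z t + (z t)^2)"
  have c: "continuous_on UNIV y" "continuous_on UNIV z"
    using DERIV_isCont[OF Y.dy] DERIV_isCont[OF Z.dy]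
    by (auto intro: continuous_at_imp_continuous_on)
  have "linear_ode2 ?a (\<lambda>_. 0) (\<lambda>t. y t - z t) (\<lambda>t. v t - w t)"
    unfolding linear_ode2_def
    by (auto intro!: derivative_eq_intros Y.dy Y.dv Z.dy Z.dv
        simp: field_simps power2_eq_square power3_eq_cube)
  moreover have "continuous_on UNIV ?a" by (intro continuous_intros c)
  ultimately show ?thesis using linear_ode2_trivial[of ?a _ _ s t] s by fastforce
qed

context duffing
begin

lemma continuous_y: "continuous_on S y" and continuous_v: "continuous_on S v"
  using DERIV_isCont[OF dy] DERIV_isCont[OF dv] by (auto intro: continuous_at_imp_continuous_on)

lemma position_ode: "linear_ode2 (\<lambda>t. 3 + 3/2 * (y t)^2) (\<lambda>_. 0) y v"
  unfolding linear_ode2_def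
proof (intro allI conjI dy)
  show "(v has_real_derivative 0 - (3 + 3/2 * (y t)^2) * y t) (at t)" for t
    using dv[of t] by (simp add: field_simps power2_eq_square power3_eq_cube)
qed

lemma velocity_ode:
  "linear_ode2 (\<lambda>t. 3 + 9/2 * (y t)^2) (\<lambda>_. 0) v (\<lambda>t. - (3 * y t + 3/2 * (y t)^3))"
  unfolding linear_ode2_def
proof (intro allI conjI dv)
  show "((\<lambda>t. - (3 * y t + 3/2 * (y t)^3)) has_real_derivative
      0 - (3 + 9/2 * (y t)^2) * v t) (at t)" for t
    by (auto intro!: derivative_eq_intros dy simp: field_simps power2_eq_square power3_eq_cube)
qed

lemma energy_const: "energy (y t) (v t) = energy (y s) (v s)"
proof (rule DERIV_isconst_all[where f="\<lambda>t. energy (y t) (v t)"], rule allI)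
  show "((\<lambda>t. energy (y t) (v t)) has_real_derivative 0) (at t)" for t
    unfolding energy_def
    by (auto intro!: derivative_eq_intros dy dv simp: field_simps power2_eq_square power3_eq_cube)
qed

text \<open>A second solvable Hill equation attached to the mode. Multiplying \<open>y'\<close> by a quadratic polynomial in
  \<open>y\<close> raises the coefficient of \<open>y\<^sup>2\<close> from \<open>9/2\<close> to \<open>15\<close>, just above the \<open>27/2\<close> of the torsional
  equation. Eliminating \<open>v\<^sup>2\<close> by conservation of energy, the result is divisible by \<open>y\<^sup>2 - k\<close> exactly
  under the quadratic condition on \<open>k\<close>.\<close>

lemma lame_ode:
  assumes k: "21/2 * k^2 + 24 * k = 4 * energy (y s) (v s)"
  shows "linear_ode2 (\<lambda>t. 27 + 21/2 * k + 15 * (y t)^2) (\<lambda>_. 0) (\<lambda>t. v t * ((y t)^2 - k))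
    (\<lambda>t. - (3 * y t + 3/2 * (y t)^3) * ((y t)^2 - k) + 2 * y t * (v t)^2)"
proof -
  have v2: "v t * v t = 21/4 * k * k + 12 * k - 3 * y t * y t - 3/4 * y t * y t * y t * y t" for t
    using k energy_const[of t s]
    by (simp add: energy_def power2_eq_square power4_eq_xxxx algebra_simps)
  have v3: "v t * (v t * v t) = v t * (21/4 * k * k + 12 * k - 3 * y t * y t - 3/4 * y t * y t * y t * y t)" for t
    by (simp only: v2)
  have 1: "((\<lambda>t. v t * ((y t)^2 - k)) has_real_derivative
      - (3 * y t + 3/2 * (y t)^3) * ((y t)^2 - k) + 2 * y t * (v t)^2) (at t)" for t
    by (auto intro!: derivative_eq_intros dy dv simp: field_simps power2_eq_square power3_eq_cube)
  have 2: "((\<lambda>t. - (3 * y t + 3/2 * (y t)^3) * ((y t)^2 - k) + 2 * y t * (v t)^2)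
      has_real_derivative 0 - (27 + 21/2 * k + 15 * (y t)^2) * (v t * ((y t)^2 - k))) (at t)" for t
    by (rule derivative_eq_intros dy dv refl | simp)+
      (use v3[of t] in \<open>simp add: field_simps power2_eq_square power3_eq_cube\<close>)
  show ?thesis unfolding linear_ode2_def using 1 2 by blast
qed

lemma odd_about_zero:
  assumes "y c = 0"
  shows "y (2 * c - t) = - y t"
proof -
  have "duffing (\<lambda>t. - 1 * y (2 * c + (- 1) * t)) (\<lambda>t. (- 1) * (- 1) * v (2 * c + (- 1) * t))"
    by (rule duffing_affine[OF duffing_axioms]) auto
  from duffing_unique[OF duffing_axioms this, of c t] assms show ?thesis by simp
qed

lemma even_about_turning_point:
  assumes "v c = 0"
  shows "y (2 * c - t) = y t"
proof -
  have "duffing (\<lambda>t. 1 * y (2 * c + (- 1) * t)) (\<lambda>t. 1 * (- 1) * v (2 * c + (- 1) * t))"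
    by (rule duffing_affine[OF duffing_axioms]) auto
  from duffing_unique[OF duffing_axioms this, of c t] assms show ?thesis by simp
qed

text \<open>Composing the reflections about a zero and about a turning point gives the
  antiperiod.\<close>

lemma antiperiodic:
  assumes "y p = 0" "v q = 0"
  shows "y (t + 2 * (q - p)) = - y t" "v (t + 2 * (q - p)) = - v t"
proof -
  show *: "y (t + 2 * (q - p)) = - y t" for t
    using even_about_turning_point[OF assms(2), of "2 * p - t"] odd_about_zero[OF assms(1), of t]
    by (simp add: algebra_simps)
  have "((\<lambda>t. y (t + 2 * (q - p))) has_real_derivative v (t + 2 * (q - p))) (at t)"
    using dy[of "t + 2 * (q - p)"] DERIV_shift by blast
  moreover have "((\<lambda>t. y (t + 2 * (q - p))) has_real_derivative - v t) (at t)"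
    unfolding * by (rule DERIV_minus[OF dy])
  ultimately show "v (t + 2 * (q - p)) = - v t" by (rule DERIV_unique)
qed

text \<open>Both \<open>y\<close> and \<open>v\<close> solve linear equations with coefficient at least 3, so they oscillate; the
  turning point is the first one after a zero of \<open>y\<close>.\<close>

lemma zero_then_turning_point:
  assumes "y s \<noteq> 0"
  obtains p q where "p < q" "y p = 0" "v q = 0" "\<And>t. p \<le> t \<Longrightarrow> t < q \<Longrightarrow> v t \<noteq> 0"
proof -
  obtain p where p: "y p = 0"
    by (rule zero_in_interval_pi[OF position_ode, of 0]) (auto intro: add_strict_increasing)
  have vp: "v p \<noteq> 0"
    using linear_ode2_trivial[OF _ position_ode p] assms
    by (fastforce intro!: continuous_intros continuous_y)
  obtain q' where q': "p < q'" "v q' = 0"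
    by (rule zero_in_interval_pi[OF velocity_ode, of p]) (auto intro: add_strict_increasing)
  obtain q where "p < q" "v q = 0" "\<And>t. p < t \<Longrightarrow> t < q \<Longrightarrow> v t \<noteq> 0"
    using first_zero[OF dv _ q'] vp by metis
  then show ?thesis using that p vp by (metis order_le_less)
qed

end

section \<open>Absence of coexistence at the antiperiodic multiplier\<close>

text \<open>Antiperiodicity of all solutions would give one that is even about \<open>p\<close> and vanishes at \<open>q\<close>. On
  the quarter period from \<open>p\<close> to \<open>q\<close> it oscillates faster than \<open>v\<close> and slower than \<open>v (y\<^sup>2 - k)\<close>, both
  of which satisfy the same end conditions and have too few zeros to leave room for it between
  them.\<close>

lemma (in duffing) hill_equation_not_all_antiperiodic:
  assumes pq: "p < q" and yp: "y p = 0" and vq: "v q = 0"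
    and vnz: "\<And>t. p \<le> t \<Longrightarrow> t < q \<Longrightarrow> v t \<noteq> 0"
  shows "\<exists>x u t. linear_ode2 (hill_coeff y) (\<lambda>_. 0) x u \<and> x (t + 2 * (q - p)) \<noteq> - x t"
proof (rule ccontr)
  assume "\<not> ?thesis"
  then have anti: "x (t + 2 * (q - p)) = - x t"
    if "linear_ode2 (hill_coeff y) (\<lambda>_. 0) x u" for x u t
    using that by blast
  let ?a = "hill_coeff y"
  have ac: "continuous_on UNIV ?a"
    unfolding hill_coeff_def by (intro continuous_intros continuous_y)
  obtain x u where x: "linear_ode2 ?a (\<lambda>_. 0) x u" and xq: "x q = 0" and uq: "u q = 1"
    using linear_ode2_exists[OF ac] continuous_on_const by metis
  have dx: "(x has_real_derivative u t) (at t)" for t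
    using x by (simp add: linear_ode2_def)
  have nontrivial: "x t \<noteq> 0 \<or> u t \<noteq> 0" for t
  proof (rule ccontr)
    assume "\<not> ?thesis"
    then have "x = (\<lambda>_. 0)" using linear_ode2_trivial[OF ac x] by blast
    then have "u q = 0" using dx[of q] DERIV_unique[OF _ DERIV_const] by auto
    with uq show False by simp
  qed
  have odd: "x (2 * q - t) = - x t" for t
  proof -
    have "(\<lambda>t. ?a (2 * q + (- 1) * t)) = ?a"
      by (rule ext) (simp add: hill_coeff_def even_about_turning_point[OF vq])
    with linear_ode2_affine[OF x, of "-1" "2 * q"]
    have 1: "linear_ode2 ?a (\<lambda>_. 0) (\<lambda>t. x (2 * q - t)) (\<lambda>t. - u (2 * q - t))" by simp
    have 2: "linear_ode2 ?a (\<lambda>_. 0) (\<lambda>t. - x t) (\<lambda>t. - u t)"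
      using linear_ode2_combine_homogeneous[OF x x, of "-1" 0] by simp
    show ?thesis
      using linear_ode2_unique(1)[OF ac 1 2, of q] xq by (auto dest: fun_cong[of _ _ t])
  qed
  have even: "x (2 * p - t) = x t" for t
    using anti[OF x, of "2 * p - t"] odd[of t] by (simp add: algebra_simps)
  have up: "u p = 0"
  proof -
    have "linear_ode2 (\<lambda>t. ?a (2 * p - t)) (\<lambda>_. 0) x (\<lambda>t. - u (2 * p - t))"
      using linear_ode2_affine[OF x, of "-1" "2 * p"] by (simp add: even)
    from linear_ode2_velocity_unique[OF x this] have "u p = - u p" by (auto dest: fun_cong[of _ _ p])
    then show ?thesis by simp
  qed
  \<comment> \<open>The Wronskian with \<open>v\<close> vanishes at both ends, so its derivative has a zero inside, where \<open>v \<noteq> 0\<close>.\<close>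
  obtain r where r: "p < r" "r < q" "x r = 0"
  proof -
    let ?D = "\<lambda>t. u t * v t - x t * (- (3 * y t + 3/2 * (y t)^3))"
    have D: "(?D has_real_derivative (3 + 9/2 * (y t)^2 - ?a t) * (x t * v t)) (at t)" for t
      by (rule wronskian_deriv[OF x velocity_ode])
    have "?D p = ?D q" using up yp xq vq by simp
    from Rolle_derivative[OF D pq this] obtain t where
      t: "p < t" "t < q" and "(3 + 9/2 * (y t)^2 - ?a t) * (x t * v t) = 0" by blast
    moreover have "3 + 9/2 * (y t)^2 - ?a t < 0"
      using zero_le_power2[of "y t"] unfolding hill_coeff_def by linarith
    ultimately have "x t = 0" using vnz[of t] t by simp
    with t show ?thesis by (rule that)
  qed
  \<comment> \<open>The nonnegative root of \<open>21/2 k\<^sup>2 + 24 k = 4 E\<close>, where \<open>E\<close> is the energy.\<close>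
  define k where "k = (sqrt (576 + 168 * energy (y p) (v p)) - 24) / 21"
  have E: "energy (y p) (v p) \<ge> 0" by (simp add: energy_def)
  then have k0: "k \<ge> 0" by (simp add: k_def real_le_rsqrt)
  have "21 * k + 24 = sqrt (576 + 168 * energy (y p) (v p))" by (simp add: k_def field_simps)
  then have "(21 * k + 24)^2 = 576 + 168 * energy (y p) (v p)" using E by simp
  then have k: "21/2 * k^2 + 24 * k = 4 * energy (y p) (v p)"
    by (simp add: power2_eq_square algebra_simps)
  note w = lame_ode[OF k]
  have less: "?a t < 27 + 21/2 * k + 15 * (y t)^2" for t
    using k0 zero_le_power2[of "y t"] unfolding hill_coeff_def by linarith
  \<comment> \<open>Neumann data at \<open>p\<close> up to the first zero \<open>r1\<close>, then Dirichlet data up to the next zero \<open>r2\<close>.\<close>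
  obtain r1 where r1: "p < r1" "r1 \<le> r" "x r1 = 0" "\<And>t. p < t \<Longrightarrow> t < r1 \<Longrightarrow> x t \<noteq> 0"
    using first_zero[OF dx nontrivial r(1,3)] by metis
  have "r1 < q" using r1 r by linarith
  obtain r2 where r2: "r1 < r2" "r2 \<le> q" "x r2 = 0" "\<And>t. r1 < t \<Longrightarrow> t < r2 \<Longrightarrow> x t \<noteq> 0"
    using first_zero[OF dx nontrivial \<open>r1 < q\<close> xq] by metis
  obtain c1 where c1: "p < c1" "c1 < r1" "v c1 * ((y c1)^2 - k) = 0"
    using sturm_comparison[OF x w r1(1) less r1(4) r1(3)] up yp by auto
  obtain c2 where c2: "r1 < c2" "c2 < r2" "v c2 * ((y c2)^2 - k) = 0"
    using sturm_comparison[OF x w r2(1) less r2(4) r2(3)] r1(3) by auto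
  \<comment> \<open>Two zeros of \<open>y\<^sup>2 - k\<close> would force a turning point before \<open>q\<close>.\<close>
  have "v c1 \<noteq> 0" "v c2 \<noteq> 0" using c1 c2 r1(2) r(2) r2(1,2) by (intro vnz; simp)+
  with c1(3) c2(3) have y12: "(y c1)^2 = (y c2)^2" by simp
  have dy2: "((\<lambda>t. (y t)^2) has_real_derivative 2 * y t * v t) (at t)" for t
    by (auto intro!: derivative_eq_intros dy)
  have "c1 < c2" using c1 c2 by simp
  from Rolle_derivative[OF dy2 this y12] obtain m where m: "c1 < m" "m < c2" "2 * y m * v m = 0"
    by blast
  have "p < m" "m < q" using m c1 c2 r2 by auto
  with m(3) vnz[of m] yp have "y p = y m" by simp
  from Rolle_derivative[OF dy \<open>p < m\<close> this] obtain n where n: "p < n" "n < m" "v n = 0"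
    by blast
  with \<open>m < q\<close> vnz[of n] show False by simp
qed

section \<open>Periodic coefficients and antiperiodic forcing\<close>

lemma linear_ode2_shift:
  assumes "linear_ode2 a f x v" and "\<And>t. a (t + \<tau>) = a t"
  shows "linear_ode2 a (\<lambda>t. f (t + \<tau>)) (\<lambda>t. x (t + \<tau>)) (\<lambda>t. v (t + \<tau>))"
  using linear_ode2_affine[OF assms(1), of 1 \<tau>] assms(2) by (simp add: add.commute[of \<tau>])

text \<open>The Cayley--Hamilton identity for the translation by \<open>\<tau>\<close> on the two-dimensional space of solutions:
  its determinant is 1 by constancy of the Wronskian, and \<open>D\<close> is its trace.\<close>

lemma hill_shift_recurrence:
  assumes ac: "continuous_on UNIV a" and per: "\<And>t. a (t + \<tau>) = a t"
  shows "\<exists>D. \<forall>x v t. linear_ode2 a (\<lambda>_. 0) x v \<longrightarrow> x (t + \<tau> + \<tau>) - D * x (t + \<tau>) + x t = 0"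
proof -
  obtain c c' where c: "linear_ode2 a (\<lambda>_. 0) c c'" "c 0 = 1" "c' 0 = 0"
    using linear_ode2_exists[OF ac] continuous_on_const by metis
  obtain s s' where s: "linear_ode2 a (\<lambda>_. 0) s s'" "s 0 = 0" "s' 0 = 1"
    using linear_ode2_exists[OF ac] continuous_on_const by metis
  have det: "c' \<tau> * s \<tau> - c \<tau> * s' \<tau> = -1"
    using wronskian_const[OF c(1) s(1), of \<tau> 0] c s by simp
  define D where "D = c \<tau> + s' \<tau>"
  show ?thesis
  proof (intro exI[of _ D] allI impI)
    fix x v t assume x: "linear_ode2 a (\<lambda>_. 0) x v"
    have rep: "z r = z 0 * c r + w 0 * s r" "w r = z 0 * c' r + w 0 * s' r"
      if "linear_ode2 a (\<lambda>_. 0) z w" for z w r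
      using linear_ode2_unique[OF ac that
          linear_ode2_combine_homogeneous[OF c(1) s(1), of "z 0" "w 0"], of 0] c s
      by (auto dest: fun_cong[of _ _ r])
    note x1 = linear_ode2_shift[OF x per]
    note x2 = linear_ode2_shift[OF x1 per]
    have z: "linear_ode2 a (\<lambda>_. 0) (\<lambda>t. 1 * (1 * x (t + \<tau> + \<tau>) + - D * x (t + \<tau>)) + 1 * x t)
      (\<lambda>t. 1 * (1 * v (t + \<tau> + \<tau>) + - D * v (t + \<tau>)) + 1 * v t)"
      by (intro linear_ode2_combine_homogeneous x x1 x2)
    have e: "x \<tau> = x 0 * c \<tau> + v 0 * s \<tau>" "v \<tau> = x 0 * c' \<tau> + v 0 * s' \<tau>"
      "x (\<tau> + \<tau>) = x \<tau> * c \<tau> + v \<tau> * s \<tau>" "v (\<tau> + \<tau>) = x \<tau> * c' \<tau> + v \<tau> * s' \<tau>"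
      using rep[OF x, of \<tau>] rep[OF x1, of \<tau>] by simp_all
    have "x (\<tau> + \<tau>) - D * x \<tau> + x 0 = x 0 * (c' \<tau> * s \<tau> - c \<tau> * s' \<tau>) + x 0"
      "v (\<tau> + \<tau>) - D * v \<tau> + v 0 = v 0 * (c' \<tau> * s \<tau> - c \<tau> * s' \<tau>) + v 0"
      unfolding e(3,4) unfolding e(1,2) D_def by (simp_all add: algebra_simps)
    with linear_ode2_trivial[OF ac z, of 0 t] det
    show "x (t + \<tau> + \<tau>) - D * x (t + \<tau>) + x t = 0" by simp
  qed
qed

lemma globally_bounded_combine:
  assumes "globally_bounded x" "globally_bounded z"
  shows "globally_bounded (\<lambda>t. c * x t + d * z t)"
proof -
  obtain A B where A: "\<And>t. t \<ge> 0 \<Longrightarrow> \<bar>x t\<bar> \<le> A" and B: "\<And>t. t \<ge> 0 \<Longrightarrow> \<bar>z t\<bar> \<le> B"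
    using assms unfolding globally_bounded_def by blast
  have "\<bar>c * x t + d * z t\<bar> \<le> \<bar>c\<bar> * A + \<bar>d\<bar> * B" if "t \<ge> 0" for t
  proof -
    have "\<bar>c * x t + d * z t\<bar> \<le> \<bar>c\<bar> * \<bar>x t\<bar> + \<bar>d\<bar> * \<bar>z t\<bar>"
      by (metis abs_mult abs_triangle_ineq)
    also have "\<dots> \<le> \<bar>c\<bar> * A + \<bar>d\<bar> * B"
      using A[OF that] B[OF that] by (intro add_mono mult_left_mono) auto
    finally show ?thesis .
  qed
  then show ?thesis unfolding globally_bounded_def by blast
qed

lemma antiperiodic_iterate:
  fixes g :: "real \<Rightarrow> real"
  assumes "\<And>t. g (t + \<tau>) = - g t"
  shows "g (t + real n * \<tau>) = (-1) ^ n * g t"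
proof (induction n)
  case (Suc n)
  have "g (t + real (Suc n) * \<tau>) = g (t + real n * \<tau> + \<tau>)" by (simp add: algebra_simps)
  then show ?case using Suc assms by simp
qed simp

lemma antiperiodic_imp_globally_bounded:
  assumes g: "continuous_on UNIV g" and anti: "\<And>t. g (t + \<tau>) = - g t" and \<tau>: "\<tau> > 0"
  shows "globally_bounded g"
proof -
  have "compact (g ` {0..\<tau>})"
    using g by (intro compact_continuous_image) (auto intro: continuous_on_subset)
  then obtain B where B: "\<And>t. t \<in> {0..\<tau>} \<Longrightarrow> \<bar>g t\<bar> \<le> B"
    using compact_imp_bounded bounded_iff by (metis imageI real_norm_def)
  have "\<bar>g t\<bar> \<le> B" if t: "t \<ge> 0" for t
  proof -
    define n where "n = nat \<lfloor>t / \<tau>\<rfloor>"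
    have n: "real n = \<lfloor>t / \<tau>\<rfloor>" using t \<tau> by (simp add: n_def)
    have 1: "real n \<le> t / \<tau>" unfolding n by (rule of_int_floor_le)
    have 2: "t / \<tau> < real n + 1" unfolding n by (rule floor_correct[THEN conjunct2, simplified])
    have "t - real n * \<tau> \<in> {0..\<tau>}"
      using 1 2 \<tau> by (simp add: pos_le_divide_eq pos_divide_less_eq algebra_simps)
    moreover have "\<bar>g t\<bar> = \<bar>g (t - real n * \<tau>)\<bar>"
      using antiperiodic_iterate[of g \<tau> "t - real n * \<tau>" n, OF anti] by (simp add: abs_mult power_abs)
    ultimately show ?thesis using B by simp
  qed
  then show ?thesis unfolding globally_bounded_def by blast
qed

text \<open>The recurrence says \<open>(S + 1)\<^sup>2 x = 0\<close> for the translation \<open>S\<close> by \<open>\<tau>\<close>. With \<open>k = (S + 1) x\<close> the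
  iterates are \<open>S\<^sup>n x = (-1)\<^sup>n (x - n k)\<close>, which is unbounded unless \<open>k\<close> vanishes.\<close>

lemma double_multiplier_imp_antiperiodic:
  fixes x :: "real \<Rightarrow> real"
  assumes rec: "\<And>t. x (t + \<tau> + \<tau>) + 2 * x (t + \<tau>) + x t = 0"
    and bdd: "globally_bounded x" and \<tau>: "\<tau> > 0"
  shows "x (t + \<tau>) = - x t"
proof -
  define k where "k t = x (t + \<tau>) + x t" for t
  have k: "k (t + \<tau>) = - k t" for t using rec[of t] by (simp add: k_def)
  have iter: "x (t + real n * \<tau>) = (-1) ^ n * (x t - real n * k t)" for n
  proof (induction n)
    case (Suc n)
    have "x (t + real (Suc n) * \<tau>) = k (t + real n * \<tau>) - x (t + real n * \<tau>)"
      by (simp add: k_def algebra_simps)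
    also have "\<dots> = (-1) ^ Suc n * (x t - real (Suc n) * k t)"
      using Suc antiperiodic_iterate[of k \<tau> t n, OF k] by (simp add: algebra_simps)
    finally show ?case .
  qed simp
  obtain B where B: "\<And>t. t \<ge> 0 \<Longrightarrow> \<bar>x t\<bar> \<le> B"
    using bdd unfolding globally_bounded_def by blast
  have "k t = 0"
  proof (rule ccontr)
    assume "k t \<noteq> 0"
    obtain n where n: "max (\<bar>t\<bar> / \<tau>) ((B + \<bar>x t\<bar>) / \<bar>k t\<bar>) < real n"
      using reals_Archimedean2 by blast
    then have "\<bar>t\<bar> < real n * \<tau>" using \<tau> by (simp add: pos_divide_less_eq)
    then have "t + real n * \<tau> \<ge> 0" by linarith
    from B[OF this] have "\<bar>x t - real n * k t\<bar> \<le> B" unfolding iter by (simp add: abs_mult power_abs)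
    then have "real n * \<bar>k t\<bar> \<le> B + \<bar>x t\<bar>"
      using abs_triangle_ineq2[of "real n * k t" "x t"]
      by (simp add: abs_mult abs_minus_commute)
    with n \<open>k t \<noteq> 0\<close> show False by (simp add: pos_divide_less_eq)
  qed
  then show ?thesis by (simp add: k_def)
qed

text \<open>The defect \<open>e = (S + 1) p\<close> of antiperiodicity is a homogeneous solution. From
  \<open>S\<^sup>2 - D S + 1 = 0\<close> one gets \<open>(S + 1) (D + 1 - S) = D + 2\<close>, so if \<open>D \<noteq> -2\<close> a homogeneous solution \<open>h\<close>
  with \<open>(S + 1) h = e\<close> is available, and \<open>p - h\<close> is antiperiodic. If \<open>D = -2\<close>, boundedness would
  make all homogeneous solutions antiperiodic.\<close>

lemma antiperiodic_forcing_bounded: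
  assumes ac: "continuous_on UNIV a" and per: "\<And>t. a (t + \<tau>) = a t"
    and anti: "\<And>t. f (t + \<tau>) = - f t" and \<tau>: "\<tau> > 0"
    and bdd: "\<And>x v. linear_ode2 a (\<lambda>_. 0) x v \<Longrightarrow> globally_bounded x"
    and ex: "\<exists>x v t. linear_ode2 a (\<lambda>_. 0) x v \<and> x (t + \<tau>) \<noteq> - x t"
    and p: "linear_ode2 a f p p'"
  shows "globally_bounded p"
proof -
  obtain D where D: "\<And>x v t. linear_ode2 a (\<lambda>_. 0) x v \<Longrightarrow> x (t + \<tau> + \<tau>) - D * x (t + \<tau>) + x t = 0"
    using hill_shift_recurrence[OF ac per] by blast
  have D2: "2 + D \<noteq> 0"
  proof
    assume "2 + D = 0"
    then have "D = -2" by simp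
    with D have "x (t + \<tau>) = - x t" if "linear_ode2 a (\<lambda>_. 0) x v" for x v t
      using that by (intro double_multiplier_imp_antiperiodic bdd \<tau>) auto
    with ex show False by blast
  qed
  define e where "e t = p (t + \<tau>) + p t" for t
  define e' where "e' t = p' (t + \<tau>) + p' t" for t
  have e: "linear_ode2 a (\<lambda>_. 0) e e'"
    unfolding e_def[abs_def] e'_def[abs_def]
    using linear_ode2_combine[OF linear_ode2_shift[OF p per] p, of 1 1] anti by simp
  define h where "h t = (D + 1) / (2 + D) * e t + - 1 / (2 + D) * e (t + \<tau>)" for t
  have h: "linear_ode2 a (\<lambda>_. 0) h (\<lambda>t. (D + 1) / (2 + D) * e' t + - 1 / (2 + D) * e' (t + \<tau>))"
    unfolding h_def[abs_def] by (intro linear_ode2_combine_homogeneous linear_ode2_shift e per)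
  have "h (t + \<tau>) + h t = e t" for t
  proof -
    have scaled: "(2 + D) * h t = (D + 1) * e t - e (t + \<tau>)" for t
      using D2 by (simp add: h_def right_diff_distrib)
    have "(2 + D) * (h (t + \<tau>) + h t) = (D + 1) * (e (t + \<tau>) + e t) - e (t + \<tau> + \<tau>) - e (t + \<tau>)"
      unfolding distrib_left[of "2 + D"] scaled by (simp add: algebra_simps)
    also have "\<dots> = (2 + D) * e t" using D[OF e, of t] by (simp add: algebra_simps)
    finally show ?thesis using D2 by simp
  qed
  then have "p (t + \<tau>) - h (t + \<tau>) = - (p t - h t)" for t
    by (simp add: e_def algebra_simps) (metis add.commute add_diff_cancel_right')
  then have "globally_bounded (\<lambda>t. p t - h t)"
    using linear_ode2_continuous(1)[OF p] linear_ode2_continuous(1)[OF h] \<tau>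
    by (intro antiperiodic_imp_globally_bounded[of _ \<tau>] continuous_intros)
  from globally_bounded_combine[OF this bdd[OF h], of 1 1] show ?thesis by simp
qed

section \<open>Stability and boundedness\<close>

text \<open>On an interval of length 1 the velocity equals a difference of two values of \<open>x\<close> somewhere, and
  the bounded acceleration controls how far it can drift from there.\<close>

lemma bounded_solution_bounded_velocity:
  assumes x: "linear_ode2 a (\<lambda>_. 0) x v" and a: "\<And>t. \<bar>a t\<bar> \<le> A" and bdd: "globally_bounded x"
  shows "globally_bounded v"
proof -
  obtain C where C: "\<And>t. t \<ge> 0 \<Longrightarrow> \<bar>x t\<bar> \<le> C"
    using bdd unfolding globally_bounded_def by blast
  have dx: "(x has_real_derivative v t) (at t)" "(v has_real_derivative - (a t * x t)) (at t)" for t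
    using x by (simp_all add: linear_ode2_def)
  have "\<bar>v t\<bar> \<le> 2 * C + A * C" if t: "t \<ge> 0" for t
  proof -
    obtain r where r: "t < r" "r < t + 1" "x (t + 1) - x t = (t + 1 - t) * v r"
      using MVT2[of t "t + 1" x v] dx by auto
    obtain q where q: "t < q" "q < r" "v r - v t = (r - t) * - (a q * x q)"
      using MVT2[of t r v "\<lambda>q. - (a q * x q)"] dx r by auto
    have "\<bar>v r - v t\<bar> = (r - t) * \<bar>a q * x q\<bar>" using q(3) r(1) by (simp add: abs_mult)
    also have "\<dots> \<le> 1 * (A * C)"
      using r q t a[of q] C[of q] by (intro mult_mono) (auto simp: abs_mult intro!: mult_mono)
    finally have "\<bar>v r - v t\<bar> \<le> A * C" by simp
    moreover have "\<bar>v r\<bar> \<le> 2 * C" using r(3) C[of t] C[of "t + 1"] t by simp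
    ultimately show ?thesis by linarith
  qed
  then show ?thesis unfolding globally_bounded_def by blast
qed

lemma solves_ode2_linear_iff:
  "solves_ode2 (\<lambda>t u. - (a t * u) + f t) x \<longleftrightarrow> linear_ode2 a f x (deriv x)"
  by (simp add: solves_ode2_def linear_ode2_def DERIV_deriv_iff_real_differentiable algebra_simps)

lemma solves_hill_iff: "solves_hill y x \<longleftrightarrow> linear_ode2 (hill_coeff y) (\<lambda>_. 0) x (deriv x)"
  unfolding solves_hill_def by (simp flip: solves_ode2_linear_iff)

lemma solves_forced_hill_iff:
  "solves_forced_hill \<delta> y x \<longleftrightarrow> linear_ode2 (hill_coeff y) (\<lambda>t. - (\<delta> * deriv y t)) x (deriv x)"
  unfolding solves_forced_hill_def by (simp flip: solves_ode2_linear_iff)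

lemma linear_ode2_deriv: "linear_ode2 a f x v \<Longrightarrow> deriv x = v"
  by (auto simp: linear_ode2_def DERIV_imp_deriv)

text \<open>By linearity: rescaling brings any solution into the basin of stability, and conversely every
  solution is the combination of two bounded fundamental solutions, with its initial data as
  coefficients.\<close>

lemma isolated_stable_iff_solutions_bounded:
  assumes ac: "continuous_on UNIV (hill_coeff y)" and A: "\<And>t. \<bar>hill_coeff y t\<bar> \<le> A"
  shows "torsionally_stable_isolated y \<longleftrightarrow>
    (\<forall>x v. linear_ode2 (hill_coeff y) (\<lambda>_. 0) x v \<longrightarrow> globally_bounded x)" (is "?L \<longleftrightarrow> ?R")
proof
  assume ?L
  then obtain r where r: "r > 0" and small: "\<And>x t. \<lbrakk>solves_hill y x; \<bar>x 0\<bar> < r; \<bar>deriv x 0\<bar> < r; t \<ge> 0\<rbrakk>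
      \<Longrightarrow> \<bar>x t\<bar> < 1"
    unfolding torsionally_stable_isolated_def by (meson zero_less_one)
  show ?R
  proof (intro allI impI)
    fix x v assume x: "linear_ode2 (hill_coeff y) (\<lambda>_. 0) x v"
    define m where "m = \<bar>x 0\<bar> + \<bar>v 0\<bar> + 1"
    define c where "c = r / m"
    have m: "m > 0" and c: "c > 0" using r by (auto simp: m_def c_def)
    have cx: "linear_ode2 (hill_coeff y) (\<lambda>_. 0) (\<lambda>t. c * x t) (\<lambda>t. c * v t)"
      using linear_ode2_combine_homogeneous[OF x x, of c 0] by simp
    have "c * w < r" if "w < m" for w
      using that r m by (simp add: c_def pos_divide_less_eq)
    then have "\<bar>c * x 0\<bar> < r" "\<bar>c * v 0\<bar> < r"
      using c by (auto simp: abs_mult m_def)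
    then have "\<bar>c * x t\<bar> < 1" if "t \<ge> 0" for t
      using small[of "\<lambda>t. c * x t" t] that cx linear_ode2_deriv[OF cx] by (simp add: solves_hill_iff)
    then have "\<bar>x t\<bar> \<le> 1 / c" if "t \<ge> 0" for t
      using that c by (simp add: abs_mult pos_le_divide_eq mult.commute less_imp_le)
    then show "globally_bounded x" unfolding globally_bounded_def by blast
  qed
next
  assume R: ?R
  obtain c c' where c: "linear_ode2 (hill_coeff y) (\<lambda>_. 0) c c'" "c 0 = 1" "c' 0 = 0"
    using linear_ode2_exists[OF ac] continuous_on_const by metis
  obtain s s' where s: "linear_ode2 (hill_coeff y) (\<lambda>_. 0) s s'" "s 0 = 0" "s' 0 = 1"
    using linear_ode2_exists[OF ac] continuous_on_const by metis
  have "globally_bounded c" "globally_bounded c'" "globally_bounded s" "globally_bounded s'"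
    using R c(1) s(1) bounded_solution_bounded_velocity[OF c(1) A]
      bounded_solution_bounded_velocity[OF s(1) A] by blast+
  then obtain B1 B2 B3 B4 where "\<forall>t\<ge>0. \<bar>c t\<bar> \<le> B1" "\<forall>t\<ge>0. \<bar>c' t\<bar> \<le> B2"
    "\<forall>t\<ge>0. \<bar>s t\<bar> \<le> B3" "\<forall>t\<ge>0. \<bar>s' t\<bar> \<le> B4"
    unfolding globally_bounded_def by blast
  moreover define B where "B = max 1 (max (max B1 B2) (max B3 B4))"
  ultimately have B: "\<bar>c t\<bar> \<le> B" "\<bar>c' t\<bar> \<le> B" "\<bar>s t\<bar> \<le> B" "\<bar>s' t\<bar> \<le> B" if "t \<ge> 0" for t
    using that by (auto simp: le_max_iff_disj)
  have B1: "B \<ge> 1" by (simp add: B_def)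
  show ?L
    unfolding torsionally_stable_isolated_def
  proof (intro allI impI)
    fix \<epsilon> :: real assume \<epsilon>: "\<epsilon> > 0"
    define r where "r = \<epsilon> / (2 * B)"
    have "\<bar>x t\<bar> < \<epsilon> \<and> \<bar>deriv x t\<bar> < \<epsilon>"
      if x: "solves_hill y x" "\<bar>x 0\<bar> < r" "\<bar>deriv x 0\<bar> < r" and t: "t \<ge> 0" for x t
    proof -
      have rep: "x t = x 0 * c t + deriv x 0 * s t" "deriv x t = x 0 * c' t + deriv x 0 * s' t"
        using linear_ode2_unique[OF ac x(1)[unfolded solves_hill_iff]
            linear_ode2_combine_homogeneous[OF c(1) s(1), of "x 0" "deriv x 0"], of 0] c s
        by (auto dest: fun_cong[of _ _ t])
      have est: "\<bar>x 0 * p + deriv x 0 * q\<bar> < \<epsilon>" if "\<bar>p\<bar> \<le> B" "\<bar>q\<bar> \<le> B" for p q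
      proof -
        have "\<bar>x 0 * p + deriv x 0 * q\<bar> \<le> \<bar>x 0\<bar> * \<bar>p\<bar> + \<bar>deriv x 0\<bar> * \<bar>q\<bar>"
          by (metis abs_mult abs_triangle_ineq)
        also have "\<dots> \<le> \<bar>x 0\<bar> * B + \<bar>deriv x 0\<bar> * B"
          using that by (intro add_mono mult_left_mono) auto
        also have "\<dots> < r * B + r * B"
          using x B1 by (intro add_strict_mono mult_strict_right_mono) auto
        also have "\<dots> = \<epsilon>" using B1 by (simp add: r_def)
        finally show ?thesis .
      qed
      show ?thesis unfolding rep using est B[OF t] by blast
    qed
    moreover have "r > 0" using \<epsilon> B1 by (simp add: r_def)
    ultimately show "\<exists>r>0. \<forall>\<xi>. solves_hill y \<xi> \<and> \<bar>\<xi> 0\<bar> < r \<and> \<bar>deriv \<xi> 0\<bar> < r \<longrightarrow>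
        (\<forall>t\<ge>0. \<bar>\<xi> t\<bar> < \<epsilon> \<and> \<bar>deriv \<xi> t\<bar> < \<epsilon>)"
      by blast
  qed
qed

theorem proposition2:
  fixes \<delta> \<eta>\<^sub>0 \<eta>\<^sub>1 :: real and y :: "real \<Rightarrow> real"
  assumes "\<delta> > 0"
    and "vertical_mode \<eta>\<^sub>0 \<eta>\<^sub>1 y"
  shows "torsionally_stable_isolated y \<longleftrightarrow> torsionally_stable_aero \<delta> y"
proof -
  let ?a = "hill_coeff y" and ?f = "\<lambda>t. - (\<delta> * deriv y t)"
  let ?bounded = "\<forall>x v. linear_ode2 ?a (\<lambda>_. 0) x v \<longrightarrow> globally_bounded x"
  interpret duffing y "deriv y"
    using assms(2) by unfold_locales
      (auto simp: vertical_mode_def solves_ode2_def DERIV_deriv_iff_real_differentiable)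
  have ac: "continuous_on UNIV ?a"
    unfolding hill_coeff_def by (intro continuous_intros continuous_y)
  have fc: "continuous_on UNIV ?f" by (intro continuous_intros continuous_v)
  \<comment> \<open>Conservation of energy bounds \<open>y\<close>, hence the Hill coefficient.\<close>
  have A: "\<bar>?a t\<bar> \<le> 7 + 9 * energy (y 0) (deriv y 0)" for t
  proof -
    have "3/2 * (y t)^2 \<le> energy (y t) (deriv y t)" by (simp add: energy_def)
    also have "\<dots> = energy (y 0) (deriv y 0)" by (rule energy_const)
    finally have "27/2 * (y t)^2 \<le> 9 * energy (y 0) (deriv y 0)" by simp
    then show ?thesis by (simp add: hill_coeff_def)
  qed
  have "?bounded \<longleftrightarrow> torsionally_stable_aero \<delta> y"
  proof
    assume R: ?bounded
    show "torsionally_stable_aero \<delta> y"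
      unfolding torsionally_stable_aero_def
    proof (intro allI impI)
      fix x assume "solves_forced_hill \<delta> y x"
      then have x: "linear_ode2 ?a ?f x (deriv x)" by (simp add: solves_forced_hill_iff)
      show "globally_bounded x"
      proof (cases "\<exists>s. y s \<noteq> 0")
        case True
        then obtain p q where pq: "p < q" "y p = 0" "deriv y q = 0"
          "\<And>t. p \<le> t \<Longrightarrow> t < q \<Longrightarrow> deriv y t \<noteq> 0"
          using zero_then_turning_point by metis
        show ?thesis
        proof (rule antiperiodic_forcing_bounded[OF ac])
          show "\<exists>x v t. linear_ode2 ?a (\<lambda>_. 0) x v \<and> x (t + 2 * (q - p)) \<noteq> - x t"
            by (rule hill_equation_not_all_antiperiodic[OF pq])
        qed (use R x pq antiperiodic[OF pq(2,3)] in \<open>auto simp: hill_coeff_def\<close>)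
      next
        case False
        then have "y = (\<lambda>_. 0)" by auto
        then have "?f = (\<lambda>_. 0)" by simp
        with R x show ?thesis by metis
      qed
    qed
  next
    assume aero: "torsionally_stable_aero \<delta> y"
    show ?bounded
    proof (intro allI impI)
      fix x v assume x: "linear_ode2 ?a (\<lambda>_. 0) x v"
      have bdd: "globally_bounded z" if "linear_ode2 ?a ?f z w" for z w
        using aero that linear_ode2_deriv[OF that]
        by (simp add: torsionally_stable_aero_def solves_forced_hill_iff)
      obtain z w where z: "linear_ode2 ?a ?f z w"
        using linear_ode2_exists[OF ac fc] by metis
      have "linear_ode2 ?a ?f (\<lambda>t. z t + x t) (\<lambda>t. w t + v t)"
        using linear_ode2_combine[OF z x, of 1 1] by simp
      from globally_bounded_combine[OF bdd[OF this] bdd[OF z], of 1 "-1"]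
      show "globally_bounded x" by simp
    qed
  qed
  with isolated_stable_iff_solutions_bounded[OF ac A] show ?thesis by simp
qed

end
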